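(* Let $\mathcal{E}^2$ be a classical overlapping generations economy with fiat money satisfying the standing assumptions listed in the context, $\mathcal{H}^2$ its set of monetary equilibria (price of money normalized to $1$), $\mathcal{E}^G$ the associated economy with Government and $\mathcal{H}^G$ its set of equilibria. Let $\rho:\mathcal{H}^G\to\mathbb{R}^\infty_{++}$, $\rho(r,q)=p$, with $p_1=q_1$ and $p_t=q_t/\prod_{i=1}^{t-1}(1+r_i)$, $t\ge2$. Fix $\theta>0$, a past price level $\Vert q_0\Vert>0$ and an inflation target $\pi^*>-1$. For $(r,q)\in\mathcal{H}^G$ let $\pi_t=\Vert q_{t+1}\Vert/\Vert q_t\Vert-1$, $t\ge0$, and consider the Taylor rule $$\mathcal{T}_1(r,q)=(r_1+\theta(\pi_0-\pi^* ),\,r_2+\theta(\pi_1-\pi^* ),\ldots),$$ with set of stable equilibria $\mathcal{S}_{\mathcal{T}_1}=\{(r,q)\in\mathcal{H}^G\mid r=\mathcal{T}_1(r,q)\}$. Then $$\mathcal{S}_{\mathcal{T}_1}=\rho^{-1}\big(\{p\in\mathcal{H}^2\mid\Vert p_1\Vert=(1+\pi^* )\Vert q_0\Vert\}\big)\cap\{(r,q)\in\mathcal{H}^G\mid\pi_t=\pi^*\ \text{for all } t\ge0\}.$$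
   Context: Notation: $\Vert c\Vert=\sum_i|c_i|$; $\mathbb{R}_+^n$, $\mathbb{R}_{++}^n$ are the vectors with non-negative, resp. strictly positive, coordinates; $p_t=(p_{t1},\ldots,p_{tL_t})\in\mathbb{R}^{L_t}$. Vectors indexed by the commodities of some periods are regarded as vectors over all commodities, with $0$ in the remaining coordinates. $\Vert q_0\Vert>0$ is a given constant (the price level of the period preceding $t=1$). Economy $\mathcal{E}^2$: commodity periods are $t=1,2,\ldots$, with $L_t\ge1$ perishable commodities in period $t$. $G_t$ ($t\ge0$) is the (finite, non-empty) generation born in period $t$. A household $h\in G_t$, $t\ge1$, lives in periods $t,t+1$ and has consumption set $\mathbb{R}^{L_t+L_{t+1}}_+$, a nonzero endowment $e^h=(e^h_t,e^h_{t+1})\in\mathbb{R}^{L_t+L_{t+1}}_+$ and a utility $u^h:\mathbb{R}^{L_t+L_{t+1}}_+\to\mathbb{R}$. A household $h\in G_0$ has a utility $u^h:\mathbb{R}^{L_1}_+\to\mathbb{R}$, a nonzero endowment $e^h=e^h_1\in\mathbb{R}^{L_1}_+$ and an amount of fiat money $m^h\ge0$, with $\sum_{h\in G_0}m^h=1$. All utilities are continuous, non-decreasing, without local maxima and semi-strictly quasiconcave (i.e. $u(\tilde c)\ge u(c)$ implies $u(\alpha\tilde c+(1-\alpha)c)\ge u(c)$ for $0\le\alpha\le1$, and $u(\tilde c)>u(c)$ implies $u(\alpha\tilde c+(1-\alpha)c)>u(c)$ for $0<\alpha\le1$). $\sum_{t\ge0}\sum_{h\in G_t}e^h\in\mathbb{R}^\infty_{++}$.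 Demand in $\mathcal{E}^2$ (assumed single-valued): for $h\in G_t$, $t\ge1$, $x^h(p_t,p_{t+1})=(x^h_t,x^h_{t+1})(p_t,p_{t+1})$ maximizes $u^h(c)$ over $c\in\mathbb{R}^{L_t+L_{t+1}}_+$ with $(p_t,p_{t+1})\cdot(c-e^h)\le0$. For $h\in G_0$, $x^h_1(p_m,p_1)$ maximizes $u^h(c)$ over $c\in\mathbb{R}^{L_1}_+$ with $p_1\cdot(c-e^h_1)\le p_mm^h$, $(p_m,p_1)\in\mathbb{R}_+\times\mathbb{R}^{L_1}_{++}$. An equilibrium of $\mathcal{E}^2$ is $(p_m,p)$, $p_m\ge0$, $p=(p_1,p_2,\ldots)\in\mathbb{R}^\infty_{++}$, with $\sum_{h\in G_0}x^h_1(p_m,p_1)+\sum_{h\in G_1}x^h_1(p_1,p_2)=\sum_{h\in G_0\cup G_1}e^h_1$ and $\sum_{h\in G_{t-1}}x^h_t(p_{t-1},p_t)+\sum_{h\in G_t}x^h_t(p_t,p_{t+1})=\sum_{h\in G_{t-1}\cup G_t}e^h_t$ for $t\ge2$. $\mathcal{H}^2$ is the set of $p\in\mathbb{R}^\infty_{++}$ such that $(1,p)$ is an equilibrium. An equilibrium is Pareto optimal if no family of non-negative consumption bundles with the same aggregate as the equilibrium allocation gives every household at least its equilibrium utility and some household strictly more. Standing assumptions on $\mathcal{E}^2$: (a) there are $0<\alpha_{\min}<\alpha_{\max}$ with $\sum_{h\in G_{t+1}}\Vert e^h_{t+1}\Vert/\sum_{h\in G_t}\Vert e^h_{t+1}\Vert\in(\alpha_{\min},\alpha_{\max})$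 for all $t\ge0$; put $\beta=\max\{1+\alpha_{\min}^{-1},1+\alpha_{\max}\}$. (b) For every $j\ge0$ all households in $\bigcup_{t=0}^jG_t$ are indirectly resource related to one another, where $h'$ is resource related to $h''$ if for every family of non-negative consumption bundles $\{c^h\}_{h\in\bigcup_{t=0}^jG_t}$ with $\sum_hc^h\le\sum_he^h$ there are another such family $\{\tilde c^h\}$ and $y\ge0$ over the commodities of periods $1,\ldots,j+1$ with $\sum_h\tilde c^h\le\sum_he^h+y$, $u^h(\tilde c^h)\ge u^h(c^h)$ for all $h$, $u^{h''}(\tilde c^{h''})>u^{h''}(c^{h''})$, and $y_{ti}>0$ only if $e^{h'}_{ti}>0$; "indirectly" means via a finite chain of households each resource related to the next. (c) An equilibrium $(p_m,p)$ of $\mathcal{E}^2$ is Pareto optimal iff $\sum_{t=1}^\infty(\Vert p_t\Vert\sum_{h\in G_t}\Vert e^h_t\Vert)^{-1}=+\infty$. (d) With $\mathcal{B}_t(\sigma)=\{p\in\mathbb{R}^{L_t+L_{t+1}}_{++}\mid\sigma\le p_i\le\sigma^{-1}\ \forall i\}$, for all $t\ge1$ there is $\sigma_t\in(0,1)$ such that $(p_t/p_{t1},p_{t+1}/p_{t1})\notin\mathcal{B}_t(\sigma_t)$ implies $\sum_{h\in G_t}\Vert x^h(p_t,p_{t+1})\Vert>\beta\sum_{h\in G_t}\Vert e^h\Vert$; moreover $\inf_{t\ge1}\sigma_t>0$ and $\sup_{t\ge1}L_t<\infty$. (e) With $s^h(p_t,p_{t+1})=\frac{p_t}{\Vert p_t\Vert}\cdot(e^h_t-x^h_t(p_t,p_{t+1}))$,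 there are $\varepsilon,\delta>0$ such that for all $t\ge1$ and $(p_t/p_{t1},p_{t+1}/p_{t1})\in\mathcal{B}_t(\sigma_t)$, $\sum_{h\in G_t}s^h(p_t,p_{t+1})\le\delta\sum_{h\in G_t}\Vert e^h_t\Vert$ implies $\frac{\Vert p_t\Vert}{\Vert p_{t+1}\Vert}\le\frac1{1+\varepsilon}\frac{\sum_{h\in G_{t+1}}\Vert e^h_{t+1}\Vert}{\sum_{h\in G_t}\Vert e^h_t\Vert}$. (f) There is $\lambda>0$ such that for $p_1\in\mathbb{R}^{L_1}_{++}$, $\min_ip_{1i}<\lambda$ implies $\sum_{h\in G_0}\Vert x^h_1(1,p_1)\Vert>\beta\sum_{h\in G_0}\Vert e^h_1\Vert$. Economy $\mathcal{E}^G$: same preferences and endowments as $\mathcal{E}^2$. A monetary policy is a sequence of nominal interest rates $r=(r_1,r_2,\ldots)\in\mathbb{R}^\infty_+$; $q=(q_1,q_2,\ldots)\in\mathbb{R}^\infty_{++}$, $q_t\in\mathbb{R}^{L_t}_{++}$, is a sequence of spot prices in current money. Household $h\in G_t$, $t\ge1$, demands $\tilde x^h(r_t,q_t,q_{t+1})=(\tilde x^h_t,\tilde x^h_{t+1})$, the maximizer of $u^h(c)$ over $c\in\mathbb{R}^{L_t+L_{t+1}}_+$ with $(q_t,(1+r_t)^{-1}q_{t+1})\cdot(c-e^h)=0$. Household $h\in G_0$ holds $b^h=m^h$ government bonds and demands $\tilde x^h_1(q_1)$, the maximizer of $u^h(c)$ over $c\in\mathbb{R}^{L_1}_+$ with $q_1\cdot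 c=b^h+q_1\cdot e^h_1$. $(r,q)\in\mathbb{R}^\infty_+\times\mathbb{R}^\infty_{++}$ is an equilibrium of $\mathcal{E}^G$ if $\sum_{h\in G_0}\tilde x^h_1(q_1)+\sum_{h\in G_1}\tilde x^h_1(r_1,q_1,q_2)=\sum_{h\in G_0}e^h_1+\sum_{h\in G_1}e^h_1$ and $\sum_{h\in G_{t-1}}\tilde x^h_t(r_{t-1},q_{t-1},q_t)+\sum_{h\in G_t}\tilde x^h_t(r_t,q_t,q_{t+1})=\sum_{h\in G_{t-1}}e^h_t+\sum_{h\in G_t}e^h_t$ for $t\ge2$; $\mathcal{H}^G$ is the set of these. The values of $\mathcal{T}_1$ are regarded as elements of $\mathbb{R}^\infty$. *)

theory Defs
  imports "HOL-Analysis.Function_Topology" "HOL-Library.Disjoint_Sets"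
begin

section \<open>Commodities and households\<close>

text \<open>
  Periods are numbered from 1, and so are the commodities within a period: the commodities are the
  pairs \<open>(t, i)\<close> with \<open>1 \<le> t\<close> and \<open>i \<in> {1..goods E t}\<close>. A vector over all commodities is a function
  of \<open>t\<close> and \<open>i\<close> that vanishes off the commodities, and \<open>v t\<close> is its block of period \<open>t\<close>.
  Likewise a sequence \<open>(r\<^sub>1, r\<^sub>2, \<dots>)\<close> is a function that vanishes at 0.
\<close>

type_synonym cvec = "nat \<Rightarrow> nat \<Rightarrow> real"

text \<open>
  The value of \<open>goods\<close> at 0 plays no role, and neither do the values of \<open>money\<close> outside
  generation 0 and of \<open>util\<close> outside the consumption sets.
\<close>

record 'h olg_economy =
  goods :: "nat \<Rightarrow> nat"
  gen :: "nat \<Rightarrow> 'h set"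
  endow :: "'h \<Rightarrow> cvec"
  util :: "'h \<Rightarrow> cvec \<Rightarrow> real"
  money :: "'h \<Rightarrow> real"

definition lifetime :: "nat \<Rightarrow> nat set" where
  "lifetime t = (if t = 0 then {1} else {t, t + 1})"

definition cons_set :: "'h olg_economy \<Rightarrow> nat \<Rightarrow> cvec set" where
  "cons_set E t = {c. (\<forall>s i. 0 \<le> c s i) \<and>
     (\<forall>s i. \<not> (s \<in> lifetime t \<and> i \<in> {1..goods E s}) \<longrightarrow> c s i = 0)}"

definition pdot :: "'h olg_economy \<Rightarrow> nat \<Rightarrow> (nat \<Rightarrow> real) \<Rightarrow> (nat \<Rightarrow> real) \<Rightarrow> real" where
  "pdot E t a v = (\<Sum>i = 1..goods E t. a i * v i)"

definition pnorm :: "'h olg_economy \<Rightarrow> nat \<Rightarrow> (nat \<Rightarrow> real) \<Rightarrow> real" where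
  "pnorm E t v = (\<Sum>i = 1..goods E t. \<bar>v i\<bar>)"

definition life_norm :: "'h olg_economy \<Rightarrow> nat \<Rightarrow> cvec \<Rightarrow> real" where
  "life_norm E t c = (\<Sum>s\<in>lifetime t. pnorm E s (c s))"

definition pos_block :: "'h olg_economy \<Rightarrow> nat \<Rightarrow> (nat \<Rightarrow> real) \<Rightarrow> bool" where
  "pos_block E t a \<longleftrightarrow> (\<forall>i\<in>{1..goods E t}. 0 < a i)"

definition price_systems :: "'h olg_economy \<Rightarrow> cvec set" where
  "price_systems E = {p. (\<forall>t\<ge>1. pos_block E t (p t)) \<and>
     (\<forall>t i. \<not> (1 \<le> t \<and> i \<in> {1..goods E t}) \<longrightarrow> p t i = 0)}"

definition semistrictly_quasiconcave_on :: "cvec set \<Rightarrow> (cvec \<Rightarrow> real) \<Rightarrow> bool" where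
  "semistrictly_quasiconcave_on X u \<longleftrightarrow> (\<forall>c\<in>X. \<forall>c'\<in>X. \<forall>\<alpha>.
     (u c' \<ge> u c \<and> 0 \<le> \<alpha> \<and> \<alpha> \<le> 1 \<longrightarrow> u (\<lambda>s i. \<alpha> * c' s i + (1 - \<alpha>) * c s i) \<ge> u c) \<and>
     (u c' > u c \<and> 0 < \<alpha> \<and> \<alpha> \<le> 1 \<longrightarrow> u (\<lambda>s i. \<alpha> * c' s i + (1 - \<alpha>) * c s i) > u c))"

text \<open>
  Topological notions refer to the product topology, which on a consumption set is the Euclidean
  one since only finitely many coordinates vary there.
\<close>

definition admissible_utility_on :: "cvec set \<Rightarrow> (cvec \<Rightarrow> real) \<Rightarrow> bool" where
  "admissible_utility_on X u \<longleftrightarrow>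
     continuous_on X u \<and>
     (\<forall>c\<in>X. \<forall>c'\<in>X. c \<le> c' \<longrightarrow> u c \<le> u c') \<and>
     (\<forall>c\<in>X. \<not> (\<forall>\<^sub>F c' in at c within X. u c' \<le> u c)) \<and>
     semistrictly_quasiconcave_on X u"

text \<open>
  Only generations \<open>t - 1\<close> and \<open>t\<close> own commodities of period \<open>t\<close>, so the aggregate endowment of
  the economy, an infinite sum over generations, reduces in each coordinate to two finite sums.
\<close>

definition olg_economy :: "'h olg_economy \<Rightarrow> bool" where
  "olg_economy E \<longleftrightarrow>
     (\<forall>t\<ge>1. 1 \<le> goods E t) \<and>
     (\<forall>t. finite (gen E t) \<and> gen E t \<noteq> {}) \<and>
     disjoint_family (gen E) \<and>
     (\<forall>t. \<forall>h\<in>gen E t. endow E h \<in> cons_set E t \<and> (\<exists>s i. endow E h s i \<noteq> 0)) \<and>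
     (\<forall>t. \<forall>h\<in>gen E t. admissible_utility_on (cons_set E t) (util E h)) \<and>
     (\<forall>h\<in>gen E 0. 0 \<le> money E h) \<and> (\<Sum>h\<in>gen E 0. money E h) = 1 \<and>
     (\<forall>t\<ge>1. \<forall>i\<in>{1..goods E t}.
        0 < (\<Sum>h\<in>gen E (t - 1). endow E h t i) + (\<Sum>h\<in>gen E t. endow E h t i))"


section \<open>The economy with fiat money\<close>

definition budget0 :: "'h olg_economy \<Rightarrow> 'h \<Rightarrow> real \<Rightarrow> (nat \<Rightarrow> real) \<Rightarrow> cvec set" where
  "budget0 E h pm a =
     {c \<in> cons_set E 0. pdot E 1 a (\<lambda>i. c 1 i - endow E h 1 i) \<le> pm * money E h}"

definition budget :: "'h olg_economy \<Rightarrow> nat \<Rightarrow> 'h \<Rightarrow> (nat \<Rightarrow> real) \<Rightarrow> (nat \<Rightarrow> real) \<Rightarrow> cvec set" where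
  "budget E t h a b =
     {c \<in> cons_set E t. pdot E t a (\<lambda>i. c t i - endow E h t i)
        + pdot E (t + 1) b (\<lambda>i. c (t + 1) i - endow E h (t + 1) i) \<le> 0}"

definition demand0 :: "'h olg_economy \<Rightarrow> 'h \<Rightarrow> real \<Rightarrow> (nat \<Rightarrow> real) \<Rightarrow> cvec" where
  "demand0 E h pm a = (THE c. is_arg_max (util E h) (\<lambda>c. c \<in> budget0 E h pm a) c)"

definition demand :: "'h olg_economy \<Rightarrow> nat \<Rightarrow> 'h \<Rightarrow> (nat \<Rightarrow> real) \<Rightarrow> (nat \<Rightarrow> real) \<Rightarrow> cvec" where
  "demand E t h a b = (THE c. is_arg_max (util E h) (\<lambda>c. c \<in> budget E t h a b) c)"

definition single_valued_demand :: "'h olg_economy \<Rightarrow> bool" where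
  "single_valued_demand E \<longleftrightarrow>
     (\<forall>h\<in>gen E 0. \<forall>pm\<ge>0. \<forall>a. pos_block E 1 a \<longrightarrow>
        (\<exists>!c. is_arg_max (util E h) (\<lambda>c. c \<in> budget0 E h pm a) c)) \<and>
     (\<forall>t\<ge>1. \<forall>h\<in>gen E t. \<forall>a b. pos_block E t a \<and> pos_block E (t + 1) b \<longrightarrow>
        (\<exists>!c. is_arg_max (util E h) (\<lambda>c. c \<in> budget E t h a b) c))"

text \<open>An allocation \<open>x\<close> assigns the bundle \<open>x t h\<close> to the household \<open>h\<close> of generation \<open>t\<close>.\<close>

definition market_clearing :: "'h olg_economy \<Rightarrow> (nat \<Rightarrow> 'h \<Rightarrow> cvec) \<Rightarrow> bool" where
  "market_clearing E x \<longleftrightarrow> (\<forall>t\<ge>1. \<forall>i\<in>{1..goods E t}.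
     (\<Sum>h\<in>gen E (t - 1). x (t - 1) h t i) + (\<Sum>h\<in>gen E t. x t h t i) =
     (\<Sum>h\<in>gen E (t - 1). endow E h t i) + (\<Sum>h\<in>gen E t. endow E h t i))"

definition allocation :: "'h olg_economy \<Rightarrow> real \<Rightarrow> cvec \<Rightarrow> nat \<Rightarrow> 'h \<Rightarrow> cvec" where
  "allocation E pm p t h = (if t = 0 then demand0 E h pm (p 1) else demand E t h (p t) (p (t + 1)))"

definition equilibrium :: "'h olg_economy \<Rightarrow> real \<Rightarrow> cvec \<Rightarrow> bool" where
  "equilibrium E pm p \<longleftrightarrow>
     0 \<le> pm \<and> p \<in> price_systems E \<and> market_clearing E (allocation E pm p)"

definition monetary_equilibria :: "'h olg_economy \<Rightarrow> cvec set" where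
  "monetary_equilibria E = {p \<in> price_systems E. equilibrium E 1 p}"

definition pareto_optimal :: "'h olg_economy \<Rightarrow> (nat \<Rightarrow> 'h \<Rightarrow> cvec) \<Rightarrow> bool" where
  "pareto_optimal E x \<longleftrightarrow> \<not> (\<exists>c.
     (\<forall>t. \<forall>h\<in>gen E t. c t h \<in> cons_set E t) \<and>
     (\<forall>t\<ge>1. \<forall>i\<in>{1..goods E t}.
        (\<Sum>h\<in>gen E (t - 1). c (t - 1) h t i) + (\<Sum>h\<in>gen E t. c t h t i) =
        (\<Sum>h\<in>gen E (t - 1). x (t - 1) h t i) + (\<Sum>h\<in>gen E t. x t h t i)) \<and>
     (\<forall>t. \<forall>h\<in>gen E t. util E h (c t h) \<ge> util E h (x t h)) \<and>
     (\<exists>t. \<exists>h\<in>gen E t. util E h (c t h) > util E h (x t h)))"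


section \<open>Standing assumptions\<close>

definition agg_endow :: "'h olg_economy \<Rightarrow> nat \<Rightarrow> nat \<Rightarrow> real" where
  "agg_endow E t s = (\<Sum>h\<in>gen E t. pnorm E s (endow E h s))"

definition bounded_endowment_ratios :: "'h olg_economy \<Rightarrow> real \<Rightarrow> real \<Rightarrow> bool" where
  "bounded_endowment_ratios E \<alpha>min \<alpha>max \<longleftrightarrow> 0 < \<alpha>min \<and> \<alpha>min < \<alpha>max \<and>
     (\<forall>t. agg_endow E (t + 1) (t + 1) / agg_endow E t (t + 1) \<in> {\<alpha>min<..<\<alpha>max})"

definition first_gens :: "'h olg_economy \<Rightarrow> nat \<Rightarrow> 'h set" where
  "first_gens E j = (\<Union>t\<in>{0..j}. gen E t)"

definition consumption_family :: "'h olg_economy \<Rightarrow> nat \<Rightarrow> ('h \<Rightarrow> cvec) \<Rightarrow> bool" where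
  "consumption_family E j c \<longleftrightarrow> (\<forall>t\<in>{0..j}. \<forall>h\<in>gen E t. c h \<in> cons_set E t)"

definition resource_related :: "'h olg_economy \<Rightarrow> nat \<Rightarrow> 'h \<Rightarrow> 'h \<Rightarrow> bool" where
  "resource_related E j h' h'' \<longleftrightarrow>
     (\<forall>c. consumption_family E j c \<and>
        (\<forall>s i. (\<Sum>h\<in>first_gens E j. c h s i) \<le> (\<Sum>h\<in>first_gens E j. endow E h s i)) \<longrightarrow>
      (\<exists>c' y. consumption_family E j c' \<and>
        (\<forall>s i. 0 \<le> y s i) \<and>
        (\<forall>s i. \<not> (s \<in> {1..j + 1} \<and> i \<in> {1..goods E s}) \<longrightarrow> y s i = 0) \<and>
        (\<forall>s i. (\<Sum>h\<in>first_gens E j. c' h s i) \<le> (\<Sum>h\<in>first_gens E j. endow E h s i) + y s i) \<and>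
        (\<forall>h\<in>first_gens E j. util E h (c' h) \<ge> util E h (c h)) \<and>
        util E h'' (c' h'') > util E h'' (c h'') \<and>
        (\<forall>s i. 0 < y s i \<longrightarrow> 0 < endow E h' s i)))"

definition resource_connected :: "'h olg_economy \<Rightarrow> bool" where
  "resource_connected E \<longleftrightarrow> (\<forall>j. \<forall>h\<in>first_gens E j. \<forall>h'\<in>first_gens E j.
     (\<lambda>k k'. k \<in> first_gens E j \<and> k' \<in> first_gens E j \<and> resource_related E j k k')\<^sup>*\<^sup>* h h')"

definition cass_criterion :: "'h olg_economy \<Rightarrow> bool" where
  "cass_criterion E \<longleftrightarrow> (\<forall>pm p. equilibrium E pm p \<longrightarrow>
     (pareto_optimal E (allocation E pm p) \<longleftrightarrow>
      filterlim (\<lambda>n. \<Sum>t = 1..n. inverse (pnorm E t (p t) * agg_endow E t t)) at_top sequentially))"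

definition price_box :: "'h olg_economy \<Rightarrow> nat \<Rightarrow> real \<Rightarrow> ((nat \<Rightarrow> real) \<times> (nat \<Rightarrow> real)) set" where
  "price_box E t \<sigma> = {(a, b). pos_block E t a \<and> pos_block E (t + 1) b \<and>
     (\<forall>i\<in>{1..goods E t}. \<sigma> \<le> a i \<and> a i \<le> inverse \<sigma>) \<and>
     (\<forall>i\<in>{1..goods E (t + 1)}. \<sigma> \<le> b i \<and> b i \<le> inverse \<sigma>)}"

definition boundary_demand :: "'h olg_economy \<Rightarrow> real \<Rightarrow> (nat \<Rightarrow> real) \<Rightarrow> bool" where
  "boundary_demand E \<beta> \<sigma> \<longleftrightarrow>
     (\<forall>t\<ge>1. 0 < \<sigma> t \<and> \<sigma> t < 1 \<and>
       (\<forall>a b. pos_block E t a \<and> pos_block E (t + 1) b \<and>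
          (\<lambda>i. a i / a 1, \<lambda>i. b i / a 1) \<notin> price_box E t (\<sigma> t) \<longrightarrow>
          (\<Sum>h\<in>gen E t. life_norm E t (demand E t h a b)) >
            \<beta> * (\<Sum>h\<in>gen E t. life_norm E t (endow E h)))) \<and>
     0 < (INF t\<in>{1..}. \<sigma> t) \<and> bdd_above (goods E ` {1..})"

definition savings :: "'h olg_economy \<Rightarrow> nat \<Rightarrow> 'h \<Rightarrow> (nat \<Rightarrow> real) \<Rightarrow> (nat \<Rightarrow> real) \<Rightarrow> real" where
  "savings E t h a b =
     pdot E t (\<lambda>i. a i / pnorm E t a) (\<lambda>i. endow E h t i - demand E t h a b t i)"

definition low_savings_condition ::
  "'h olg_economy \<Rightarrow> (nat \<Rightarrow> real) \<Rightarrow> real \<Rightarrow> real \<Rightarrow> bool" where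
  "low_savings_condition E \<sigma> \<epsilon> \<delta> \<longleftrightarrow> 0 < \<epsilon> \<and> 0 < \<delta> \<and>
     (\<forall>t\<ge>1. \<forall>a b. pos_block E t a \<and> pos_block E (t + 1) b \<and>
        (\<lambda>i. a i / a 1, \<lambda>i. b i / a 1) \<in> price_box E t (\<sigma> t) \<and>
        (\<Sum>h\<in>gen E t. savings E t h a b) \<le> \<delta> * agg_endow E t t \<longrightarrow>
        pnorm E t a / pnorm E (t + 1) b \<le>
          1 / (1 + \<epsilon>) * (agg_endow E (t + 1) (t + 1) / agg_endow E t t))"

definition initial_boundary_demand :: "'h olg_economy \<Rightarrow> real \<Rightarrow> real \<Rightarrow> bool" where
  "initial_boundary_demand E \<beta> \<Lambda> \<longleftrightarrow> 0 < \<Lambda> \<and>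
     (\<forall>a. pos_block E 1 a \<and> Min (a ` {1..goods E 1}) < \<Lambda> \<longrightarrow>
        (\<Sum>h\<in>gen E 0. pnorm E 1 (demand0 E h 1 a 1)) > \<beta> * agg_endow E 0 1)"


section \<open>The economy with Government\<close>

definition gov_budget0 :: "'h olg_economy \<Rightarrow> 'h \<Rightarrow> (nat \<Rightarrow> real) \<Rightarrow> cvec set" where
  "gov_budget0 E h a =
     {c \<in> cons_set E 0. pdot E 1 a (c 1) = money E h + pdot E 1 a (endow E h 1)}"

definition gov_budget ::
  "'h olg_economy \<Rightarrow> nat \<Rightarrow> 'h \<Rightarrow> real \<Rightarrow> (nat \<Rightarrow> real) \<Rightarrow> (nat \<Rightarrow> real) \<Rightarrow> cvec set" where
  "gov_budget E t h rt a b =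
     {c \<in> cons_set E t. pdot E t a (\<lambda>i. c t i - endow E h t i)
        + pdot E (t + 1) (\<lambda>i. inverse (1 + rt) * b i)
            (\<lambda>i. c (t + 1) i - endow E h (t + 1) i) = 0}"

definition gov_demand0 :: "'h olg_economy \<Rightarrow> 'h \<Rightarrow> (nat \<Rightarrow> real) \<Rightarrow> cvec" where
  "gov_demand0 E h a = (THE c. is_arg_max (util E h) (\<lambda>c. c \<in> gov_budget0 E h a) c)"

definition gov_demand ::
  "'h olg_economy \<Rightarrow> nat \<Rightarrow> 'h \<Rightarrow> real \<Rightarrow> (nat \<Rightarrow> real) \<Rightarrow> (nat \<Rightarrow> real) \<Rightarrow> cvec" where
  "gov_demand E t h rt a b =
     (THE c. is_arg_max (util E h) (\<lambda>c. c \<in> gov_budget E t h rt a b) c)"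

definition gov_allocation ::
  "'h olg_economy \<Rightarrow> (nat \<Rightarrow> real) \<Rightarrow> cvec \<Rightarrow> nat \<Rightarrow> 'h \<Rightarrow> cvec" where
  "gov_allocation E r q t h =
     (if t = 0 then gov_demand0 E h (q 1) else gov_demand E t h (r t) (q t) (q (t + 1)))"

definition monetary_policies :: "(nat \<Rightarrow> real) set" where
  "monetary_policies = {r. (\<forall>t\<ge>1. 0 \<le> r t) \<and> r 0 = 0}"

definition gov_equilibria :: "'h olg_economy \<Rightarrow> ((nat \<Rightarrow> real) \<times> cvec) set" where
  "gov_equilibria E = {(r, q). r \<in> monetary_policies \<and> q \<in> price_systems E \<and>
     market_clearing E (gov_allocation E r q)}"

definition discounted_prices :: "(nat \<Rightarrow> real) \<times> cvec \<Rightarrow> cvec" where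
  "discounted_prices = (\<lambda>(r, q) t i. q t i / (\<Prod>j\<in>{1..<t}. 1 + r j))"

text \<open>\<open>Q0\<close> is the given price level of period 0; the block \<open>q 0\<close> is zero and not used.\<close>

definition price_level :: "'h olg_economy \<Rightarrow> real \<Rightarrow> cvec \<Rightarrow> nat \<Rightarrow> real" where
  "price_level E Q0 q t = (if t = 0 then Q0 else pnorm E t (q t))"

definition inflation :: "'h olg_economy \<Rightarrow> real \<Rightarrow> cvec \<Rightarrow> nat \<Rightarrow> real" where
  "inflation E Q0 q t = price_level E Q0 q (t + 1) / price_level E Q0 q t - 1"

definition taylor_rule ::
  "'h olg_economy \<Rightarrow> real \<Rightarrow> real \<Rightarrow> real \<Rightarrow> (nat \<Rightarrow> real) \<times> cvec \<Rightarrow> nat \<Rightarrow> real" where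
  "taylor_rule E Q0 \<theta> target =
     (\<lambda>(r, q) t. if t = 0 then 0 else r t + \<theta> * (inflation E Q0 q (t - 1) - target))"

definition stable_equilibria ::
  "'h olg_economy \<Rightarrow> ((nat \<Rightarrow> real) \<times> cvec \<Rightarrow> nat \<Rightarrow> real) \<Rightarrow> ((nat \<Rightarrow> real) \<times> cvec) set" where
  "stable_equilibria E T = {(r, q) \<in> gov_equilibria E. r = T (r, q)}"

end

(* Without local maxima of the utility, a utility maximizer exhausts the budget, so maximizing under
   the budget equality of the economy with Government is the same as maximizing under the budget
   inequality of the economy with fiat money. Budgets are homogeneous in prices, hence discounting
   the spot prices of an equilibrium with Government always yields a monetary equilibrium. As theta
   is nonzero, the Taylor rule fixes a policy exactly when inflation is on target in every period,
   and inflation at t = 0 being on target is the condition on the initial price level. *)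
theory Submission
  imports Defs
begin

text \<open>If the constraint were slack at \<open>c\<close>, continuity of \<open>g\<close> would
  keep it slack at all nearby points of \<open>X\<close>. These points are then feasible, so
  \<open>c\<close> would be a local maximum of \<open>u\<close> on the whole of
  \<open>X\<close>.\<close>

lemma is_arg_max_binding_constraint:
  fixes u :: "'a::topological_space \<Rightarrow> real" and g :: "'a \<Rightarrow> real"
  assumes "continuous_on X g"
    and no_local_max: "\<forall>c\<in>X. \<not> (\<forall>\<^sub>F c' in at c within X. u c' \<le> u c)"
    and max: "is_arg_max u (\<lambda>c. c \<in> X \<and> g c \<le> w) c"
  shows "g c = w"
proof (rule ccontr)
  assume "g c \<noteq> w"
  with max have c: "c \<in> X" "g c < w" by (auto simp: is_arg_max_def)
  have "(g \<longlongrightarrow> g c) (at c within X)"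
    using assms(1) c(1) by (auto simp: continuous_on_def)
  then have "\<forall>\<^sub>F c' in at c within X. g c' < w"
    using c(2) by (rule order_tendstoD)
  moreover have "\<forall>\<^sub>F c' in at c within X. c' \<in> X"
    by (simp add: eventually_at_topological) blast
  ultimately have "\<forall>\<^sub>F c' in at c within X. u c' \<le> u c"
    by eventually_elim (use max in \<open>force simp: is_arg_max_def not_less\<close>)
  with no_local_max c(1) show False by blast
qed

text \<open>Passing from the inequality to the equality only needs the constraint to bind. The
  converse rests on existence: a maximizer \<open>d\<close> under the inequality binds too, so it
  competes under the equality, and \<open>c\<close> is at least as good as \<open>d\<close>.\<close>

lemma is_arg_max_equality_iff_inequality:
  fixes u :: "'a::topological_space \<Rightarrow> real" and g :: "'a \<Rightarrow> real"
  assumes "continuous_on X g"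
    and "\<forall>c\<in>X. \<not> (\<forall>\<^sub>F c' in at c within X. u c' \<le> u c)"
    and "\<exists>c. is_arg_max u (\<lambda>c. c \<in> X \<and> g c \<le> w) c"
  shows "is_arg_max u (\<lambda>c. c \<in> X \<and> g c = w) c \<longleftrightarrow> is_arg_max u (\<lambda>c. c \<in> X \<and> g c \<le> w) c"
proof
  assume "is_arg_max u (\<lambda>c. c \<in> X \<and> g c \<le> w) c"
  with is_arg_max_binding_constraint[OF assms(1,2) this]
  show "is_arg_max u (\<lambda>c. c \<in> X \<and> g c = w) c"
    by (auto simp: is_arg_max_def)
next
  assume c: "is_arg_max u (\<lambda>c. c \<in> X \<and> g c = w) c"
  obtain d where d: "is_arg_max u (\<lambda>c. c \<in> X \<and> g c \<le> w) d"
    using assms(3) by blast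
  with is_arg_max_binding_constraint[OF assms(1,2) d] c
  show "is_arg_max u (\<lambda>c. c \<in> X \<and> g c \<le> w) c"
    by (force simp: is_arg_max_def not_less)
qed

lemma continuous_on_coordinate2:
  "continuous_on X (\<lambda>c :: 'a \<Rightarrow> 'b \<Rightarrow> 'c::topological_space. c s i)"
proof -
  have "continuous_on X (\<lambda>c :: 'a \<Rightarrow> 'b \<Rightarrow> 'c. c s)"
    by (rule continuous_on_subset[OF continuous_on_product_coordinates]) simp
  then show ?thesis
    by (rule continuous_on_product_then_coordinatewise)
qed

lemma continuous_on_pdot: "continuous_on X (\<lambda>c. pdot E t a (\<lambda>i. c s i - e i))"
  unfolding pdot_def by (intro continuous_intros continuous_on_coordinate2)

lemma pdot_scale: "pdot E t (\<lambda>i. k * a i) v = k * pdot E t a v"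
  by (simp add: pdot_def sum_distrib_left mult.assoc)

lemma pdot_diff_right: "pdot E t a (\<lambda>i. v i - w i) = pdot E t a v - pdot E t a w"
  by (simp add: pdot_def sum_subtractf right_diff_distrib)

lemma olg_economy_no_local_max:
  assumes "olg_economy E" "h \<in> gen E t"
  shows "\<forall>c\<in>cons_set E t. \<not> (\<forall>\<^sub>F c' in at c within cons_set E t. util E h c' \<le> util E h c)"
  using assms unfolding olg_economy_def admissible_utility_on_def by blast

text \<open>Both demands are definite descriptions, so it suffices that their defining predicates
  agree; existence of a maximizer comes from single-valued demand.\<close>

lemma gov_demand0_eq:
  assumes "olg_economy E" "single_valued_demand E" "h \<in> gen E 0" "pos_block E 1 a"
  shows "gov_demand0 E h a = demand0 E h 1 a"
proof -
  let ?g = "\<lambda>c. pdot E 1 a (\<lambda>i. c 1 i - endow E h 1 i)"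
  \<comment> \<open>Moving the value of the endowment to the left puts both budgets in terms of the
    same excess expenditure \<open>?g\<close> and the bound \<open>money E h\<close>, the price of
    money being 1.\<close>
  have eq: "(\<lambda>c. c \<in> gov_budget0 E h a) = (\<lambda>c. c \<in> cons_set E 0 \<and> ?g c = money E h)"
    by (auto simp: gov_budget0_def pdot_diff_right)
  have ineq: "(\<lambda>c. c \<in> budget0 E h 1 a) = (\<lambda>c. c \<in> cons_set E 0 \<and> ?g c \<le> money E h)"
    by (auto simp: budget0_def)
  have "\<exists>!c. is_arg_max (util E h) (\<lambda>c. c \<in> budget0 E h 1 a) c"
    using assms(2-4) unfolding single_valued_demand_def by simp
  then have ex: "\<exists>c. is_arg_max (util E h) (\<lambda>c. c \<in> cons_set E 0 \<and> ?g c \<le> money E h) c"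
    unfolding ineq by blast
  show ?thesis
    unfolding gov_demand0_def demand0_def eq ineq
      is_arg_max_equality_iff_inequality[OF continuous_on_pdot
        olg_economy_no_local_max[OF assms(1,3)] ex] ..
qed

text \<open>The free factor \<open>k\<close> records homogeneity of degree zero in prices. It leaves
  room for the discounting accumulated before period \<open>t\<close>, whereas \<open>rt\<close>
  only discounts between \<open>t\<close> and \<open>t + 1\<close>.\<close>

lemma gov_demand_eq:
  assumes "olg_economy E" "single_valued_demand E" "1 \<le> t" "h \<in> gen E t"
    and "pos_block E t a" "pos_block E (t + 1) b" "0 \<le> rt" "0 < k"
  shows "gov_demand E t h rt a b =
    demand E t h (\<lambda>i. k * a i) (\<lambda>i. k * (inverse (1 + rt) * b i))"
proof -
  let ?a = "\<lambda>i. k * a i" and ?b = "\<lambda>i. k * (inverse (1 + rt) * b i)"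
  let ?g = "\<lambda>c. pdot E t ?a (\<lambda>i. c t i - endow E h t i)
    + pdot E (t + 1) ?b (\<lambda>i. c (t + 1) i - endow E h (t + 1) i)"
  have g: "?g c = k * (pdot E t a (\<lambda>i. c t i - endow E h t i)
    + pdot E (t + 1) (\<lambda>i. inverse (1 + rt) * b i)
        (\<lambda>i. c (t + 1) i - endow E h (t + 1) i))" for c
    by (simp only: pdot_scale distrib_left)
  \<comment> \<open>The right-hand side of the budget is 0, so scaling by a positive
    \<open>k\<close> leaves the constraint unchanged.\<close>
  have eq: "(\<lambda>c. c \<in> gov_budget E t h rt a b) = (\<lambda>c. c \<in> cons_set E t \<and> ?g c = 0)"
    using \<open>0 < k\<close> unfolding g by (auto simp: gov_budget_def)
  have ineq: "(\<lambda>c. c \<in> budget E t h ?a ?b) = (\<lambda>c. c \<in> cons_set E t \<and> ?g c \<le> 0)"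
    by (auto simp: budget_def)
  have "pos_block E t ?a" "pos_block E (t + 1) ?b"
    using assms(5-8) by (auto simp: pos_block_def)
  then have "\<exists>!c. is_arg_max (util E h) (\<lambda>c. c \<in> budget E t h ?a ?b) c"
    using assms(2-4) unfolding single_valued_demand_def by blast
  then have ex: "\<exists>c. is_arg_max (util E h) (\<lambda>c. c \<in> cons_set E t \<and> ?g c \<le> 0) c"
    unfolding ineq by blast
  show ?thesis
    unfolding gov_demand_def demand_def eq ineq
      is_arg_max_equality_iff_inequality[OF continuous_on_add[OF continuous_on_pdot continuous_on_pdot]
        olg_economy_no_local_max[OF assms(1,4)] ex] ..
qed

lemma discount_factor_pos:
  assumes "r \<in> monetary_policies"
  shows "0 < (\<Prod>j\<in>{1..<t}. 1 + r j)"
  using assms by (intro prod_pos) (auto simp: monetary_policies_def add_pos_nonneg)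

lemma discounted_prices_in_price_systems:
  assumes "r \<in> monetary_policies" "q \<in> price_systems E"
  shows "discounted_prices (r, q) \<in> price_systems E"
  using assms(2) discount_factor_pos[OF assms(1)]
  by (auto simp: price_systems_def discounted_prices_def pos_block_def)

lemma gov_allocation_eq:
  assumes "olg_economy E" "single_valued_demand E"
    and r: "r \<in> monetary_policies" and q: "q \<in> price_systems E" and h: "h \<in> gen E t"
  shows "gov_allocation E r q t h = allocation E 1 (discounted_prices (r, q)) t h"
proof (cases "t = 0")
  case True
  \<comment> \<open>The discount product for period 1 is empty, so the initial generation faces
    \<open>q 1\<close> itself.\<close>
  have "pos_block E 1 (q 1)" using q by (simp add: price_systems_def)
  with gov_demand0_eq[OF assms(1,2)] h True show ?thesis
    by (simp add: gov_allocation_def allocation_def discounted_prices_def)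
next
  case False
  \<comment> \<open>The accumulated discount factor is common to both periods of life; period
    \<open>t + 1\<close> carries the one further factor \<open>inverse (1 + r t)\<close>, since
    \<open>1 \<le> t\<close> puts \<open>t\<close> into \<open>{1..<t + 1}\<close>.\<close>
  define k where "k = inverse (\<Prod>j\<in>{1..<t}. 1 + r j)"
  have "0 < k" using discount_factor_pos[OF r] by (simp add: k_def)
  have pos: "pos_block E t (q t)" "pos_block E (t + 1) (q (t + 1))"
    using q False by (auto simp: price_systems_def)
  have "0 \<le> r t" using r False by (auto simp: monetary_policies_def)
  have "discounted_prices (r, q) t = (\<lambda>i. k * q t i)"
    by (simp add: discounted_prices_def k_def divide_inverse mult.commute)
  moreover have "discounted_prices (r, q) (t + 1) = (\<lambda>i. k * (inverse (1 + r t) * q (t + 1) i))"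
    using False
    by (simp add: discounted_prices_def k_def divide_inverse ac_simps)
  ultimately show ?thesis
    using gov_demand_eq[OF assms(1,2) _ h pos \<open>0 \<le> r t\<close> \<open>0 < k\<close>] False
    by (simp add: gov_allocation_def allocation_def)
qed

lemma market_clearing_cong:
  assumes "\<And>t h. h \<in> gen E t \<Longrightarrow> x t h = y t h"
  shows "market_clearing E x \<longleftrightarrow> market_clearing E y"
  unfolding market_clearing_def by (simp add: assms cong: sum.cong)

lemma discounted_prices_in_monetary_equilibria:
  assumes "olg_economy E" "single_valued_demand E" "(r, q) \<in> gov_equilibria E"
  shows "discounted_prices (r, q) \<in> monetary_equilibria E"
proof -
  have rq: "r \<in> monetary_policies" "q \<in> price_systems E"
    and "market_clearing E (gov_allocation E r q)"
    using assms(3) by (auto simp: gov_equilibria_def)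
  then have "market_clearing E (allocation E 1 (discounted_prices (r, q)))"
    using market_clearing_cong[of E "gov_allocation E r q" "allocation E 1 (discounted_prices (r, q))"]
      gov_allocation_eq[OF assms(1,2) rq] by blast
  with discounted_prices_in_price_systems[OF rq] show ?thesis
    by (simp add: monetary_equilibria_def equilibrium_def)
qed

text \<open>Coordinatewise \<open>r t\<close> cancels and leaves \<open>\<theta>\<close> times the
  inflation gap equal to 0. At index 0 the rule returns the default 0, which \<open>r 0 = 0\<close>
  matches.\<close>

lemma taylor_rule_fixed_iff:
  assumes "r 0 = 0" "\<theta> \<noteq> 0"
  shows "r = taylor_rule E Q0 \<theta> target (r, q) \<longleftrightarrow> (\<forall>t. inflation E Q0 q t = target)"
proof
  assume eq: "r = taylor_rule E Q0 \<theta> target (r, q)"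
  show "\<forall>t. inflation E Q0 q t = target"
  proof
    fix t
    show "inflation E Q0 q t = target"
      \<comment> \<open>The rate of period \<open>t + 1\<close> responds to inflation with index
        \<open>t\<close>, hence the shift.\<close>
      using fun_cong[OF eq, of "Suc t"] assms(2) by (simp add: taylor_rule_def)
  qed
qed (use assms(1) in \<open>auto simp: taylor_rule_def fun_eq_iff\<close>)

theorem proposition8:
  fixes E :: "'h olg_economy"
    and \<alpha>min \<alpha>max \<beta> \<epsilon> \<delta> \<Lambda> \<theta> Q0 target :: real
    and \<sigma> :: "nat \<Rightarrow> real"
  assumes "olg_economy E"
    and "single_valued_demand E"
    and "bounded_endowment_ratios E \<alpha>min \<alpha>max"
    and "\<beta> = max (1 + inverse \<alpha>min) (1 + \<alpha>max)"
    and "resource_connected E"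
    and "cass_criterion E"
    and "boundary_demand E \<beta> \<sigma>"
    and "low_savings_condition E \<sigma> \<epsilon> \<delta>"
    and "initial_boundary_demand E \<beta> \<Lambda>"
    and "\<theta> > 0"
    and "Q0 > 0"
    and "target > -1"
  shows "stable_equilibria E (taylor_rule E Q0 \<theta> target) =
    (discounted_prices -` {p \<in> monetary_equilibria E. pnorm E 1 (p 1) = (1 + target) * Q0}
       \<inter> gov_equilibria E) \<inter>
    {(r, q) \<in> gov_equilibria E. \<forall>t. inflation E Q0 q t = target}"
proof -
  have "r = taylor_rule E Q0 \<theta> target (r, q) \<longleftrightarrow>
      discounted_prices (r, q) \<in> monetary_equilibria E \<and>
      pnorm E 1 (discounted_prices (r, q) 1) = (1 + target) * Q0 \<and>
      (\<forall>t. inflation E Q0 q t = target)" if "(r, q) \<in> gov_equilibria E" for r q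
  proof -
    have "r 0 = 0" using that by (auto simp: gov_equilibria_def monetary_policies_def)
    then have "r = taylor_rule E Q0 \<theta> target (r, q) \<longleftrightarrow> (\<forall>t. inflation E Q0 q t = target)"
      using \<open>\<theta> > 0\<close> by (intro taylor_rule_fixed_iff) auto
    moreover have "discounted_prices (r, q) 1 = q 1"
      by (simp add: discounted_prices_def)
    \<comment> \<open>Inflation with index 0 compares \<open>pnorm E 1 (q 1)\<close> with the given
      level \<open>Q0\<close>; clearing the positive denominator gives the initial price
      level.\<close>
    moreover have "pnorm E 1 (q 1) = (1 + target) * Q0" if "inflation E Q0 q 0 = target"
      using that \<open>Q0 > 0\<close> by (auto simp: inflation_def price_level_def field_simps)
    ultimately show ?thesis
      using discounted_prices_in_monetary_equilibria[OF assms(1,2) that] by auto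
  qed
  then show ?thesis
    unfolding stable_equilibria_def by blast
qed

end
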